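(* Let $\mathfrak{A}$ be a residuated lattice and $F$ a filter of $\mathfrak{A}$. Then $\gamma_{F}(\mathfrak{A})$ is a bounded sublattice of $\Omega_{F}(\mathfrak{A})$.
   Context: A residuated lattice is an algebra $\mathfrak{A}=(A;\vee,\wedge,\odot,\rightarrow,0,1)$ such that $\ell(\mathfrak{A})=(A;\vee,\wedge,0,1)$ is a bounded lattice, $(A;\odot,1)$ is a commutative monoid, and $x\odot y\leq z$ iff $x\leq y\rightarrow z$ for all $x,y,z\in A$. A filter of $\mathfrak{A}$ is a non-empty subset $F\subseteq A$ such that $x,y\in F$ implies $x\odot y\in F$, and $x\in F$, $y\in A$ implies $x\vee y\in F$. For $x\in A$, $(F:x)=\{a\in A\mid x\vee a\in F\}$, and $\gamma_F(\mathfrak{A})=\{(F:x)\mid x\in A\}$ (the set of $F$-coannulets). An ideal of $\ell(\mathfrak{A})$ is a non-empty subset $I\subseteq A$ closed under $\vee$ and downward closed; $I\curlyvee J$ denotes the ideal generated by $I\cup J$. For $X\subseteq A$, $\omega_{F}(X)=\{a\in A\mid x\vee a\in F\text{ for some }x\in X\}$. A filter $H$ is an $\omega_F$-filter if $H=\omega_F(I)$ for some ideal $I$ of $\ell(\mathfrak{A})$; $\Omega_F(\mathfrak{A})$ is the set of all $\omega_F$-filters. $\Omega_F(\mathfrak{A})$ is a bounded distributive lattice with meet $\cap$, least element $F$, greatest element $A$, and join $G\vee^{\omega_F}H=\omega_F(I_G\curlyvee I_H)$, where $I_G,I_H$ are ideals with $G=\omega_F(I_G)$, $H=\omega_F(I_H)$.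 A bounded sublattice is a subset closed under meet and join and containing the least and greatest elements. *)

theory Defs
  imports Main
begin

text \<open>The lattice bounds \<open>0\<close> and \<open>1\<close> are \<open>bot\<close> and \<open>top\<close>; the latter is also the unit of the monoid.\<close>

class residuated_lattice = bounded_lattice + comm_monoid_mult +
  fixes residuum :: "'a \<Rightarrow> 'a \<Rightarrow> 'a"  (infixr "\<rightharpoonup>" 60)
  assumes top_eq_one: "top = 1"
    and residuation: "x * y \<le> z \<longleftrightarrow> x \<le> (y \<rightharpoonup> z)"

definition rl_filter :: "'a::residuated_lattice set \<Rightarrow> bool" where
  "rl_filter F \<longleftrightarrow> F \<noteq> {} \<and> (\<forall>x\<in>F. \<forall>y\<in>F. x * y \<in> F) \<and> (\<forall>x\<in>F. \<forall>y. sup x y \<in> F)"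

definition coannulet :: "'a::residuated_lattice set \<Rightarrow> 'a \<Rightarrow> 'a set" where
  "coannulet F x = {a. sup x a \<in> F}"

definition coannulets :: "'a::residuated_lattice set \<Rightarrow> 'a set set" where
  "coannulets F = {coannulet F x | x. True}"

definition l_ideal :: "'a::lattice set \<Rightarrow> bool" where
  "l_ideal I \<longleftrightarrow> I \<noteq> {} \<and> (\<forall>x\<in>I. \<forall>y\<in>I. sup x y \<in> I) \<and> (\<forall>x\<in>I. \<forall>y. y \<le> x \<longrightarrow> y \<in> I)"

definition l_ideal_generated :: "'a::lattice set \<Rightarrow> 'a set" where
  "l_ideal_generated X = \<Inter> {I. l_ideal I \<and> X \<subseteq> I}"

definition ideal_join :: "'a::lattice set \<Rightarrow> 'a set \<Rightarrow> 'a set" where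
  "ideal_join I J = l_ideal_generated (I \<union> J)"

definition omega :: "'a::residuated_lattice set \<Rightarrow> 'a set \<Rightarrow> 'a set" where
  "omega F X = {a. \<exists>x\<in>X. sup x a \<in> F}"

definition omega_filters :: "'a::residuated_lattice set \<Rightarrow> 'a set set" where
  "omega_filters F = {H. rl_filter H \<and> (\<exists>I. l_ideal I \<and> H = omega F I)}"

text \<open>The join of two \<open>\<omega>\<^sub>F\<close>-filters is given through representing ideals. It does not depend on
  their choice (lemma \<open>omega_join_omega\<close> below), so the description is definite.\<close>

definition omega_join :: "'a::residuated_lattice set \<Rightarrow> 'a set \<Rightarrow> 'a set \<Rightarrow> 'a set" where
  "omega_join F G H =
    (THE K. \<exists>I J. l_ideal I \<and> l_ideal J \<and> G = omega F I \<and> H = omega F J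
                \<and> K = omega F (ideal_join I J))"

definition bounded_sublattice ::
  "'b set \<Rightarrow> 'b set \<Rightarrow> ('b \<Rightarrow> 'b \<Rightarrow> 'b) \<Rightarrow> ('b \<Rightarrow> 'b \<Rightarrow> 'b) \<Rightarrow> 'b \<Rightarrow> 'b \<Rightarrow> bool" where
  "bounded_sublattice S L meet join least greatest \<longleftrightarrow>
     S \<subseteq> L \<and> (\<forall>x\<in>S. \<forall>y\<in>S. meet x y \<in> S) \<and> (\<forall>x\<in>S. \<forall>y\<in>S. join x y \<in> S)
     \<and> least \<in> S \<and> greatest \<in> S"

lemma ideal_join_eq:
  assumes "l_ideal I" "l_ideal J"
  shows "ideal_join I J = {x. \<exists>i\<in>I. \<exists>j\<in>J. x \<le> sup i j}" (is "_ = ?K")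
proof (rule antisym)
  have I: "I \<noteq> {}" "\<And>x y. x \<in> I \<Longrightarrow> y \<in> I \<Longrightarrow> sup x y \<in> I"
    and J: "J \<noteq> {}" "\<And>x y. x \<in> J \<Longrightarrow> y \<in> J \<Longrightarrow> sup x y \<in> J"
    using assms unfolding l_ideal_def by auto
  have sub: "I \<union> J \<subseteq> ?K"
    using I(1) J(1) by (auto intro: sup_ge1 sup_ge2)
  have "sup x y \<in> ?K" if "x \<in> ?K" "y \<in> ?K" for x y
  proof -
    obtain i j i' j' where *: "i \<in> I" "j \<in> J" "x \<le> sup i j" "i' \<in> I" "j' \<in> J" "y \<le> sup i' j'"
      using \<open>x \<in> ?K\<close> \<open>y \<in> ?K\<close> by blast
    have "sup x y \<le> sup (sup i j) (sup i' j')"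
      using * by (intro sup_mono)
    also have "\<dots> = sup (sup i i') (sup j j')"
      by (simp add: sup.assoc sup.left_commute)
    finally show ?thesis using * I(2) J(2) by blast
  qed
  moreover have "?K \<noteq> {}" using sub I(1) by blast
  moreover have "y \<in> ?K" if "x \<in> ?K" "y \<le> x" for x y
    using that order_trans by blast
  ultimately have "l_ideal ?K" unfolding l_ideal_def by blast
  with sub show "ideal_join I J \<subseteq> ?K"
    unfolding ideal_join_def l_ideal_generated_def by blast
  show "?K \<subseteq> ideal_join I J"
    unfolding ideal_join_def l_ideal_generated_def l_ideal_def by blast
qed

lemma omega_ideal_join:
  assumes "rl_filter F" "l_ideal I" "l_ideal J"
  shows "omega F (ideal_join I J) = {a. \<exists>i\<in>I. \<exists>j\<in>J. sup i (sup j a) \<in> F}"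
proof -
  have up: "y \<in> F" if "x \<in> F" "x \<le> y" for x y
    using assms(1) that unfolding rl_filter_def by (metis sup.absorb2)
  have "\<exists>i\<in>I. \<exists>j\<in>J. sup i (sup j a) \<in> F"
    if "i \<in> I" "j \<in> J" "x \<le> sup i j" "sup x a \<in> F" for i j x a
  proof -
    have "sup x a \<le> sup i (sup j a)"
      using that(3) by (metis sup.assoc sup_mono order_refl)
    then show ?thesis using that up by blast
  qed
  moreover have "\<exists>x. (\<exists>i\<in>I. \<exists>j\<in>J. x \<le> sup i j) \<and> sup x a \<in> F"
    if "i \<in> I" "j \<in> J" "sup i (sup j a) \<in> F" for i j a
    using that by (metis sup.assoc order_refl)
  ultimately show ?thesis
    unfolding omega_def ideal_join_eq[OF assms(2,3)] by blast
qed

lemma omega_join_omega: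
  assumes F: "rl_filter F" and "l_ideal I" "l_ideal J"
  shows "omega_join F (omega F I) (omega F J) = omega F (ideal_join I J)"
proof -
  have left: "omega F (ideal_join I1 J1) \<subseteq> omega F (ideal_join I2 J2)"
    if h: "l_ideal I1" "l_ideal J1" "l_ideal I2" "l_ideal J2"
      "omega F I1 = omega F I2" "omega F J1 = omega F J2" for I1 J1 I2 J2
  proof
    fix a assume "a \<in> omega F (ideal_join I1 J1)"
    then obtain i j where ij: "i \<in> I1" "j \<in> J1" "sup i (sup j a) \<in> F"
      using omega_ideal_join[OF F h(1,2)] by auto
    then have "sup j a \<in> omega F I2"
      unfolding h(5)[symmetric] by (auto simp: omega_def)
    then obtain i' where i': "i' \<in> I2" "sup i' (sup j a) \<in> F"
      by (auto simp: omega_def)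
    then have "sup i' a \<in> omega F J2"
      unfolding h(6)[symmetric] using ij(2) by (auto simp: omega_def sup.left_commute)
    then obtain j' where "j' \<in> J2" "sup i' (sup j' a) \<in> F"
      by (auto simp: omega_def sup.left_commute)
    with i'(1) show "a \<in> omega F (ideal_join I2 J2)"
      using omega_ideal_join[OF F h(3,4)] by auto
  qed
  show ?thesis
    unfolding omega_join_def
  proof (rule the_equality)
    show "\<exists>I' J'. l_ideal I' \<and> l_ideal J' \<and> omega F I = omega F I' \<and> omega F J = omega F J'
        \<and> omega F (ideal_join I J) = omega F (ideal_join I' J')"
      using assms by blast
  next
    fix K
    assume "\<exists>I' J'. l_ideal I' \<and> l_ideal J' \<and> omega F I = omega F I' \<and> omega F J = omega F J'
        \<and> K = omega F (ideal_join I' J')"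
    then obtain I' J' where *: "l_ideal I'" "l_ideal J'" "omega F I = omega F I'"
      "omega F J = omega F J'" "K = omega F (ideal_join I' J')" by blast
    show "K = omega F (ideal_join I J)"
      unfolding *(5) using left[of I J I' J'] left[of I' J' I J] * assms by auto
  qed
qed

end

theory Submission
  imports Defs
begin

text \<open>
  The \<open>F\<close>-coannulet of \<open>x\<close> is the \<open>\<omega>\<^sub>F\<close>-filter of the principal ideal of \<open>x\<close>, because \<open>F\<close> is
  upward closed: if some \<open>y \<le> x\<close> satisfies \<open>y \<squnion> a \<in> F\<close>, then so does \<open>x\<close> itself. Hence coannulets
  are \<open>\<omega>\<^sub>F\<close>-filters, and the lattice operations on them can be carried out on the indexing elements:
  joins are given by \<open>x \<squnion> y\<close>, since this element generates the join of the two principal ideals,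
  meets are given by \<open>x \<sqinter> y\<close>, and the bounds \<open>F\<close> and \<open>UNIV\<close> are the coannulets of \<open>bot\<close> and \<open>top\<close>.

  The underlying lattice need not be distributive, so meets need an argument: \<open>x \<squnion> a\<close> and \<open>y \<squnion> a\<close>
  may lie in \<open>F\<close> although \<open>(x \<sqinter> y) \<squnion> a\<close> need not lie above their meet. It does lie above
  their product, because the product distributes over joins (it is residuated) and every product
  is below both of its factors (the unit is the greatest element). The same expansion of a product
  of two joins shows that a coannulet is closed under products.
\<close>

lemma mult_le_left: "(x::'a::residuated_lattice) * y \<le> x"
proof -
  have "1 \<le> x \<rightharpoonup> x"
    by (simp flip: residuation)
  then have "y \<le> x \<rightharpoonup> x"
    using top_greatest[of y] unfolding top_eq_one by (rule order_trans[rotated])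
  then show ?thesis
    by (simp add: mult.commute flip: residuation)
qed

lemma mult_le_right: "(x::'a::residuated_lattice) * y \<le> y"
  using mult_le_left[of y x] by (simp add: mult.commute)

text \<open>Residuation turns each factor into a bound on a join, which splits: this is distributivity
  of the product over joins, in the form in which it is applied.\<close>

lemma sup_mult_sup_le_iff:
  fixes x :: "'a::residuated_lattice"
  shows "sup x a * sup y b \<le> w \<longleftrightarrow> x * y \<le> w \<and> x * b \<le> w \<and> a * y \<le> w \<and> a * b \<le> w"
proof -
  have left: "sup u v * z \<le> w \<longleftrightarrow> u * z \<le> w \<and> v * z \<le> w" for u v z :: 'a
    by (simp add: residuation)
  have right: "z * sup u v \<le> w \<longleftrightarrow> z * u \<le> w \<and> z * v \<le> w" for u v z :: 'a
    using left[of u v z] by (simp only: mult.commute)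
  show ?thesis
    by (auto simp: left right)
qed

lemma sup_mult_sup_le_sup_inf:
  fixes x :: "'a::residuated_lattice"
  shows "sup x a * sup y a \<le> sup (inf x y) a"
  unfolding sup_mult_sup_le_iff
  by (simp add: mult_le_left mult_le_right le_supI1 le_supI2)

lemma sup_mult_sup_le_sup_mult:
  fixes x :: "'a::residuated_lattice"
  shows "sup x a * sup x b \<le> sup x (a * b)"
  unfolding sup_mult_sup_le_iff
  by (auto intro: mult_le_left mult_le_right le_supI1 le_supI2)

lemma rl_filter_upward:
  assumes "rl_filter F" "x \<in> F" "x \<le> y"
  shows "y \<in> F"
  using assms unfolding rl_filter_def by (metis sup.absorb2)

lemma rl_filter_top:
  assumes "rl_filter F"
  shows "top \<in> F"
  using assms rl_filter_upward[OF assms] unfolding rl_filter_def by (metis ex_in_conv top_greatest)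

lemma rl_filter_coannulet:
  assumes F: "rl_filter F"
  shows "rl_filter (coannulet F x)"
proof -
  have "top \<in> coannulet F x"
    using rl_filter_top[OF F] by (simp add: coannulet_def)
  moreover have "a * b \<in> coannulet F x" if "a \<in> coannulet F x" "b \<in> coannulet F x" for a b
  proof -
    have "sup x a * sup x b \<in> F"
      using F that by (simp add: coannulet_def rl_filter_def)
    then show ?thesis
      using rl_filter_upward[OF F _ sup_mult_sup_le_sup_mult] by (simp add: coannulet_def)
  qed
  moreover have "sup a b \<in> coannulet F x" if "a \<in> coannulet F x" for a b
    using F that by (simp add: coannulet_def rl_filter_def flip: sup.assoc)
  ultimately show ?thesis
    unfolding rl_filter_def by blast
qed

lemma l_ideal_atMost: "l_ideal {..x::'a::lattice}"
  by (auto simp: l_ideal_def)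

lemma ideal_join_atMost: "ideal_join {..x} {..y} = {..sup x (y::'a::lattice)}"
proof
  show "ideal_join {..x} {..y} \<subseteq> {..sup x y}"
    by (auto simp: ideal_join_eq l_ideal_atMost intro: order_trans[OF _ sup_mono])
  show "{..sup x y} \<subseteq> ideal_join {..x} {..y}"
    by (auto simp: ideal_join_eq l_ideal_atMost)
qed

text \<open>The generator is the most favourable witness in its principal ideal: replacing a smaller
  witness by it enlarges the join, which therefore stays in \<open>F\<close>.\<close>

lemma coannulet_eq_omega_atMost:
  assumes F: "rl_filter F"
  shows "coannulet F x = omega F {..x}"
proof -
  have "sup x a \<in> F" if "y \<le> x" "sup y a \<in> F" for y a
    using rl_filter_upward[OF F that(2)] that(1) by (simp add: le_supI1)
  then show ?thesis
    by (auto simp: coannulet_def omega_def)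
qed

lemma coannulet_in_omega_filters:
  assumes "rl_filter F"
  shows "coannulet F x \<in> omega_filters F"
  using assms rl_filter_coannulet coannulet_eq_omega_atMost l_ideal_atMost
  unfolding omega_filters_def by blast

lemma coannulet_Int:
  assumes F: "rl_filter F"
  shows "coannulet F x \<inter> coannulet F y = coannulet F (inf x y)"
proof
  show "coannulet F x \<inter> coannulet F y \<subseteq> coannulet F (inf x y)"
  proof
    fix a assume "a \<in> coannulet F x \<inter> coannulet F y"
    then have "sup x a * sup y a \<in> F"
      using F by (simp add: coannulet_def rl_filter_def)
    then show "a \<in> coannulet F (inf x y)"
      using rl_filter_upward[OF F _ sup_mult_sup_le_sup_inf] by (simp add: coannulet_def)
  qed
  have "sup (inf x y) a \<le> sup x a" "sup (inf x y) a \<le> sup y a" for a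
    by (auto intro: le_supI1)
  then show "coannulet F (inf x y) \<subseteq> coannulet F x \<inter> coannulet F y"
    using rl_filter_upward[OF F] by (auto simp: coannulet_def)
qed

lemma omega_join_coannulet:
  assumes "rl_filter F"
  shows "omega_join F (coannulet F x) (coannulet F y) = coannulet F (sup x y)"
  by (simp add: assms coannulet_eq_omega_atMost omega_join_omega l_ideal_atMost ideal_join_atMost)

lemma coannulet_bot: "coannulet F bot = F"
  by (simp add: coannulet_def)

lemma coannulet_top:
  assumes "rl_filter F"
  shows "coannulet F top = UNIV"
  by (simp add: coannulet_def rl_filter_top[OF assms])

theorem proposition3p8:
  fixes F :: "'a::residuated_lattice set"
  assumes "rl_filter F"
  shows "bounded_sublattice (coannulets F) (omega_filters F) (\<inter>) (omega_join F) F UNIV"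
proof -
  have coannulets: "coannulets F = range (coannulet F)"
    by (auto simp: coannulets_def)
  have "F \<in> range (coannulet F)" "UNIV \<in> range (coannulet F)"
    using coannulet_bot[of F] coannulet_top[OF assms] by (metis rangeI)+
  then show ?thesis
    unfolding bounded_sublattice_def coannulets
    by (auto simp: coannulet_in_omega_filters coannulet_Int omega_join_coannulet assms)
qed

end
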